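(* Consider the online bin covering problem with advice, and the advice strategy $\mathsf{DH}^{b+\lg n}_2$ (with $k=2$) described in the context, where the oracle supplies exact values of $m$ and $x_m$ (with $m$ chosen by the oracle, as described, to maximize the number of bins covered by the strategy). Then for every input sequence $\sigma$ of length $n$, $$|\mathsf{DH}^{b+\lg n}_2(\sigma)| \ge \frac{3}{5}\,|\mathsf{OPT}(\sigma)| - \frac{19}{15},$$ where $|\mathsf{OPT}(\sigma)|$ is the maximum number of bins that can be covered with the items of $\sigma$ and $|\mathsf{DH}^{b+\lg n}_2(\sigma)|$ is the number of bins covered by the strategy.
   Context: Bin covering: given a sequence $\sigma$ of items with rational sizes, each item size $v$ satisfying $0<v<1$, partition the items into bins; the load of a bin is the sum of its item sizes and a bin is covered if its load is at least $1$; the goal is to maximize the number of covered bins. Online: items arrive one by one and each must be irrevocably placed in a bin (existing or newly opened) before the next arrives. Advice model: an oracle knowing the entire input and the strategy writes a bit string (using a self-delimiting encoding) on an advice tape which the strategy may read. Dual Next Fit (DNF) on a stream of items: keep one active bin, put each item into it, and when it becomes covered close it and open a new empty active bin. Fix an integer $k\ge 2$. For an integer $2\le t\le k$, an item $v$ is a $t$-item if $1/t\le v<1/(t-1)$; an item $v<1/k$ is small. Let $x_1\ge x_2\ge\dots\ge x_n$ be the items of $\sigma$ sorted in non-increasing order. Strategy $\mathsf{DH}^{b+\lg n}_k$: it first reads from the advice an integer $m$ and the value $x_m$ (the $m$-th largest item of $\sigma$). It opens $m$ critical bins, each with an initial virtual load of $x_m$; it also opens one $t$-bin for each $t\in\{2,\dots,k\}$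 and one small bin. The virtual load of a critical bin equals the sum of its small items plus either $x_m$ (if it contains no item of size $\ge x_m$ yet) or the actual size of the item of size $\ge x_m$ it contains. When an item $v$ arrives: (1) if $x_m\le v$, place $v$ in the next critical bin that does not yet contain such a (2-)item and update its virtual load; (2) if $1/k\le v<x_m$ and $v$ is a $t$-item, place $v$ in the current $t$-bin using DNF (when it becomes covered, close it and open a new $t$-bin); (3) if $v<1/k$, place $v$ in the next critical bin whose virtual load is still below $1$ and update its virtual load; if all critical bins have virtual load at least $1$, place $v$ in the small bin using DNF (when it becomes covered, close it and open a new small bin). The oracle chooses $m$ by emulating the strategy for every integer $0\le m\le n_2$, where $n_2$ is the number of $2$-items in $\sigma$, and reports a value of $m$ for which the strategy covers as many bins as possible, together with the exact value $x_m$. *)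

theory Defs
  imports Complex_Main
begin

text \<open>Optimal offline number of covered bins: maximum over all assignments of
  the n items to bins (bins can w.l.o.g. be indexed by 0..n-1) of the number
  of bins with load at least 1.\<close>
definition bin_load :: "rat list \<Rightarrow> (nat \<Rightarrow> nat) \<Rightarrow> nat \<Rightarrow> rat" where
  "bin_load xs f b = (\<Sum>i\<in>{i. i < length xs \<and> f i = b}. xs ! i)"

definition covered_bins :: "rat list \<Rightarrow> (nat \<Rightarrow> nat) \<Rightarrow> nat" where
  "covered_bins xs f = card {b. b < length xs \<and> bin_load xs f b \<ge> 1}"

definition OPT :: "rat list \<Rightarrow> nat" where
  "OPT xs = Max {covered_bins xs f | f. \<forall>i < length xs. f i < length xs}"

text \<open>State of the strategy:
  critical bins as a list of (actual load, virtual load, contains an item \<ge> x_m),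
  current load of the 2-bin (DNF), current load of the small bin (DNF),
  number of closed (covered) DNF bins.\<close>
type_synonym dh_state = "(rat \<times> rat \<times> bool) list \<times> rat \<times> rat \<times> nat"

definition dnf_add :: "rat \<Rightarrow> rat \<Rightarrow> nat \<Rightarrow> rat \<times> nat" where
  "dnf_add load v c = (if load + v \<ge> 1 then (0, Suc c) else (load + v, c))"

definition dh_step :: "rat \<Rightarrow> rat \<Rightarrow> dh_state \<Rightarrow> dh_state" where
  "dh_step xm v st = (case st of (crit, l2, ls, c) \<Rightarrow>
     if xm \<le> v \<and> (\<exists>j < length crit. \<not> snd (snd (crit ! j))) then
       (let j = (LEAST j. j < length crit \<and> \<not> snd (snd (crit ! j)));
            (a, vl, h) = crit ! j
        in (crit[j := (a + v, vl - xm + v, True)], l2, ls, c))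
     else if 1/2 \<le> v then
       (let (l2', c') = dnf_add l2 v c in (crit, l2', ls, c'))
     else if (\<exists>j < length crit. fst (snd (crit ! j)) < 1) then
       (let j = (LEAST j. j < length crit \<and> fst (snd (crit ! j)) < 1);
            (a, vl, h) = crit ! j
        in (crit[j := (a + v, vl + v, h)], l2, ls, c))
     else
       (let (ls', c') = dnf_add ls v c in (crit, l2, ls', c')))"

definition dh_run :: "nat \<Rightarrow> rat \<Rightarrow> rat list \<Rightarrow> nat" where
  "dh_run m xm xs = (case fold (dh_step xm) xs (replicate m (0, xm, False), 0, 0, 0) of
     (crit, l2, ls, c) \<Rightarrow> c + length (filter (\<lambda>b. fst b \<ge> 1) crit))"

definition n2 :: "rat list \<Rightarrow> nat" where
  "n2 xs = length (filter (\<lambda>v. 1/2 \<le> v) xs)"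

text \<open>The m-th largest item x_m (1-based); for m = 0 we use the convention
  x_0 = 1, so that no item is treated as critical.\<close>
definition xth :: "rat list \<Rightarrow> nat \<Rightarrow> rat" where
  "xth xs m = (if m = 0 then 1 else rev (sort xs) ! (m - 1))"

text \<open>DH_2^{b + lg n}: the oracle chooses m in {0..n2} maximising the number of
  covered bins and supplies the exact value x_m.\<close>
definition DH2 :: "rat list \<Rightarrow> nat" where
  "DH2 xs = Max ((\<lambda>m. dh_run m (xth xs m) xs) ` {0..n2 xs})"

end

theory Submission
  imports Defs
begin

text \<open>Let an optimal packing cover \<open>D\<close>, \<open>E\<close> and \<open>F\<close> bins with at least two, exactly one and no
  item of size at least 1/2, and put \<open>\<tau> = 1 - x_m\<close>. At most \<open>m - 1\<close> items exceed \<open>x_m\<close>, so at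
  least \<open>E - m + 1\<close> of the \<open>E\<close> bins contain small items of total size at least \<open>\<tau>\<close>.
  Truncate small sizes at \<open>\<tau>\<close>: a critical bin takes less than \<open>2\<tau>\<close> while the optimal packing
  holds at least \<open>(2F + E - m + 1)\<tau>\<close>, so all critical bins get covered when \<open>3m \<le> 2F + E + 2\<close>.
  Each of them replaces half a pair of large items, a gain of 1/2.
  For \<open>F < E/4\<close> the largest such \<open>m\<close> suffices. Otherwise take \<open>m = \<lceil>E/2\<rceil>\<close> and count untruncated
  sizes: the total is at least \<open>F + (E - m + 1)\<tau>\<close>, of which the critical bins take at most
  \<open>m(\<tau> + 1/2)\<close>; here \<open>\<tau>\<close> cancels, and Dual Next Fit covers a bin with every 3/2 of the rest.\<close>

section \<open>Counting in lists and the m-th largest item\<close>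

lemma length_filter_list_update:
  "j < length xs \<Longrightarrow> length (filter P (xs[j := y])) + of_bool (P (xs ! j))
    = length (filter P xs) + of_bool (P y)"
proof (induction xs arbitrary: j)
  case (Cons a xs)
  then show ?case by (cases j) auto
qed simp

lemma length_filter_mono:
  "(\<And>v. P v \<Longrightarrow> Q v) \<Longrightarrow> length (filter P xs) \<le> length (filter Q xs)"
  by (induction xs) (auto simp: le_SucI)

lemma length_filter_rev_sort:
  "length (filter P (rev (sort xs))) = length (filter P xs)"
  by (simp add: rev_filter[symmetric] filter_sort)

text \<open>In non-increasing order an entry strictly above the one at position \<open>m - 1\<close>
  (counted from 0) stands before it, and the first \<open>m\<close> entries are all at least as
  large. Ties are why one comparison is strict and the other is not.\<close>

lemma
  assumes "1 \<le> m" "m \<le> length xs"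
  shows length_filter_greater_xth: "length (filter (\<lambda>v. xth xs m < v) xs) < m"
    and length_filter_ge_xth: "m \<le> length (filter (\<lambda>v. xth xs m \<le> v) xs)"
proof -
  define ys where "ys = rev (sort xs)"
  have len: "length ys = length xs" by (simp add: ys_def)
  have x: "xth xs m = ys ! (m - 1)" using assms by (simp add: xth_def ys_def)
  have anti: "ys ! j \<le> ys ! i" if "i \<le> j" "j < length ys" for i j
    using that unfolding ys_def by (metis rev_rev_ident sorted_rev_nth_mono sorted_sort)
  have "{i. i < length ys \<and> ys ! (m - 1) < ys ! i} \<subseteq> {..<m - 1}"
  proof
    fix i assume "i \<in> {i. i < length ys \<and> ys ! (m - 1) < ys ! i}"
    then show "i \<in> {..<m - 1}" using anti[of "m - 1" i] by (auto simp: not_le[symmetric])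
  qed
  then have "card {i. i < length ys \<and> ys ! (m - 1) < ys ! i} \<le> m - 1"
    using card_mono[of "{..<m - 1}"] by simp
  then have "length (filter (\<lambda>v. xth xs m < v) ys) < m"
    using assms by (simp add: x length_filter_conv_card)
  then show "length (filter (\<lambda>v. xth xs m < v) xs) < m"
    by (simp add: ys_def length_filter_rev_sort)
  have "{..<m} \<subseteq> {i. i < length ys \<and> ys ! (m - 1) \<le> ys ! i}"
  proof
    fix i assume "i \<in> {..<m}"
    then show "i \<in> {i. i < length ys \<and> ys ! (m - 1) \<le> ys ! i}"
      using anti[of i "m - 1"] assms len by auto
  qed
  then have "m \<le> card {i. i < length ys \<and> ys ! (m - 1) \<le> ys ! i}"
    using card_mono[of "{i. i < length ys \<and> ys ! (m - 1) \<le> ys ! i}" "{..<m}"] by simp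
  then have "m \<le> length (filter (\<lambda>v. xth xs m \<le> v) ys)"
    by (simp add: x length_filter_conv_card)
  then show "m \<le> length (filter (\<lambda>v. xth xs m \<le> v) xs)"
    by (simp add: ys_def length_filter_rev_sort)
qed

text \<open>Otherwise all \<open>n2 xs\<close> large items, at least \<open>m\<close> of them, would
  exceed the m-th largest item, yet fewer than \<open>m\<close> items do.\<close>

lemma xth_ge_half:
  assumes "1 \<le> m" "m \<le> n2 xs"
  shows "1/2 \<le> xth xs m"
proof (rule ccontr)
  assume "\<not> 1/2 \<le> xth xs m"
  then have "length (filter (\<lambda>v. 1/2 \<le> v) xs) \<le> length (filter (\<lambda>v. xth xs m < v) xs)"
    by (intro length_filter_mono) simp
  moreover have "n2 xs \<le> length xs" by (simp add: n2_def)
  with assms have "length (filter (\<lambda>v. xth xs m < v) xs) < m"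
    by (intro length_filter_greater_xth) simp_all
  ultimately show False using assms by (simp add: n2_def)
qed

lemma xth_mem:
  assumes "1 \<le> m" "m \<le> length xs"
  shows "xth xs m \<in> set xs"
proof -
  have "rev (sort xs) ! (m - 1) \<in> set (rev (sort xs))" using assms by (intro nth_mem) simp
  then show ?thesis using assms by (simp add: xth_def)
qed

section \<open>Large and small items in an optimal packing\<close>

lemma sum_index_filter:
  "(\<Sum>i\<in>{i. i < length xs \<and> P (xs ! i)}. w (xs ! i)) = sum_list (map w (filter P xs))"
proof (induction xs rule: rev_induct)
  case (snoc x xs)
  have "{i. i < length (xs @ [x]) \<and> P ((xs @ [x]) ! i)} =
    {i. i < length xs \<and> P (xs ! i)} \<union> (if P x then {length xs} else {})"
    by (auto simp: nth_append less_Suc_eq)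
  moreover have "(\<Sum>i\<in>{i. i < length xs \<and> P (xs ! i)}. w ((xs @ [x]) ! i)) =
     (\<Sum>i\<in>{i. i < length xs \<and> P (xs ! i)}. w (xs ! i))"
    by (rule sum.cong) (auto simp: nth_append)
  ultimately show ?case using snoc by (auto simp: add.commute)
qed simp

text \<open>\<^term>\<open>D\<close>, \<^term>\<open>E\<close> and \<^term>\<open>F\<close> count the bins of an optimal packing with at least two, exactly one
  and no item of size at least 1/2.\<close>
lemma OPT_decomposition:
  assumes xs: "\<forall>v\<in>set xs. 0 < v \<and> v < 1"
  obtains D E F :: nat where "OPT xs = D + E + F" "2 * D + E \<le> n2 xs"
    "\<And>(w :: rat \<Rightarrow> rat) p q x. \<lbrakk>\<And>v. 0 < v \<Longrightarrow> 0 \<le> w v; 0 \<le> q;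
      \<And>A. \<lbrakk>A \<subseteq> {i. i < length xs \<and> xs ! i < 1/2}; 1 \<le> (\<Sum>i\<in>A. xs ! i)\<rbrakk> \<Longrightarrow> p \<le> (\<Sum>i\<in>A. w (xs ! i));
      \<And>A. \<lbrakk>A \<subseteq> {i. i < length xs \<and> xs ! i < 1/2}; 1 - x \<le> (\<Sum>i\<in>A. xs ! i)\<rbrakk> \<Longrightarrow> q \<le> (\<Sum>i\<in>A. w (xs ! i))\<rbrakk>
     \<Longrightarrow> p * of_nat F + q * (of_nat E - of_nat (length (filter (\<lambda>v. x < v) xs)))
         \<le> sum_list (map w (filter (\<lambda>v. v < 1/2) xs))"
proof -
  let ?n = "length xs"
  let ?K = "{covered_bins xs f | f. \<forall>i < ?n. f i < ?n}"
  have "covered_bins xs f \<le> ?n" for f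
    unfolding covered_bins_def
    using card_mono[of "{..<?n}" "{b. b < ?n \<and> bin_load xs f b \<ge> 1}"] by auto
  then have "finite ?K" by (intro finite_subset[of ?K "{..?n}"]) auto
  moreover have "?K \<noteq> {}" by (auto intro!: exI[of _ "\<lambda>i. i"])
  ultimately have "OPT xs \<in> ?K" unfolding OPT_def by (rule Max_in)
  then obtain f where f: "\<forall>i < ?n. f i < ?n" and opt: "OPT xs = covered_bins xs f" by auto
  define bg where "bg b = {i \<in> {i. i < ?n \<and> \<not> xs ! i < 1/2}. f i = b}" for b
  define sm where "sm b = {i \<in> {i. i < ?n \<and> xs ! i < 1/2}. f i = b}" for b
  define C where "C = {b. b < ?n \<and> bin_load xs f b \<ge> 1}"
  define DD where "DD = {b \<in> C. 2 \<le> card (bg b)}"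
  define EE where "EE = {b \<in> C. card (bg b) = 1}"
  define FF where "FF = {b \<in> C. card (bg b) = 0}"
  have fin: "finite C" "finite DD" "finite EE" "finite FF" "finite (bg b)" "finite (sm b)" for b
    by (auto simp: C_def DD_def EE_def FF_def bg_def sm_def)
  have Cu: "C = DD \<union> EE \<union> FF"
  proof (rule set_eqI)
    fix b
    have "2 \<le> card (bg b) \<or> card (bg b) = 1 \<or> card (bg b) = 0" by linarith
    then show "b \<in> C \<longleftrightarrow> b \<in> DD \<union> EE \<union> FF" by (simp only: DD_def EE_def FF_def Un_iff mem_Collect_eq) metis
  qed
  have disj: "DD \<inter> EE = {}" "(DD \<union> EE) \<inter> FF = {}" by (auto simp: DD_def EE_def FF_def)
  have 1: "OPT xs = card DD + card EE + card FF"
    unfolding opt covered_bins_def C_def[symmetric] Cu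
    using fin disj by (simp add: card_Un_disjoint)
  have load: "bin_load xs f b = (\<Sum>i\<in>bg b. xs ! i) + (\<Sum>i\<in>sm b. xs ! i)" for b
  proof -
    have "{i. i < ?n \<and> f i = b} = bg b \<union> sm b" "bg b \<inter> sm b = {}" by (auto simp: bg_def sm_def)
    then show ?thesis unfolding bin_load_def using fin by (simp add: sum.union_disjoint)
  qed
  have pos: "0 < xs ! i" if "i < ?n" for i using xs that by auto
  have CI: "C \<subseteq> {..<?n}" by (auto simp: C_def)
  have tot: "(\<Sum>b\<in>T. \<Sum>i\<in>sm b. w (xs ! i)) \<le> sum_list (map w (filter (\<lambda>v. v < 1/2) xs))"
    if w: "\<And>v. 0 < v \<Longrightarrow> 0 \<le> w v" and T: "T \<subseteq> C" for w :: "rat \<Rightarrow> rat" and T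
  proof -
    have "(\<Sum>b\<in>T. \<Sum>i\<in>sm b. w (xs ! i)) \<le> (\<Sum>b\<in>{..<?n}. \<Sum>i\<in>sm b. w (xs ! i))"
      using CI T by (intro sum_mono2) (auto intro!: sum_nonneg w pos simp: sm_def)
    also have "\<dots> = (\<Sum>i\<in>{i. i < ?n \<and> xs ! i < 1/2}. w (xs ! i))"
      unfolding sm_def using f by (intro sum.group) auto
    finally show ?thesis unfolding sum_index_filter[where w = w and P = "\<lambda>v. v < 1/2"] .
  qed
  have "(\<Sum>b\<in>{..<?n}. card (bg b)) = card {i. i < ?n \<and> \<not> xs ! i < 1/2}"
    unfolding bg_def card_eq_sum using f by (intro sum.group) auto
  also have "\<dots> = n2 xs" by (simp add: n2_def length_filter_conv_card not_less)
  finally have bgs: "(\<Sum>b\<in>{..<?n}. card (bg b)) = n2 xs" .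
  have "2 * card DD + card EE = (\<Sum>b\<in>DD. 2) + (\<Sum>b\<in>EE. 1)" by simp
  also have "\<dots> \<le> (\<Sum>b\<in>DD. card (bg b)) + (\<Sum>b\<in>EE. card (bg b))"
    by (intro add_mono sum_mono) (auto simp: DD_def EE_def)
  also have "\<dots> = (\<Sum>b\<in>DD \<union> EE. card (bg b))" using fin disj by (simp add: sum.union_disjoint)
  also have "\<dots> \<le> (\<Sum>b\<in>{..<?n}. card (bg b))" using CI Cu by (intro sum_mono2) auto
  finally have 2: "2 * card DD + card EE \<le> n2 xs" using bgs by simp
  \<comment> \<open>\<open>p\<close> and \<open>q\<close> are the weights guaranteed on small items
    of total size 1 and \<open>1 - x\<close>. Leaving \<open>w\<close> general lets one count serve
    both true and truncated sizes.\<close>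
  have 3: "p * of_nat (card FF) + q * (of_nat (card EE) - of_nat (length (filter (\<lambda>v. x < v) xs)))
         \<le> sum_list (map w (filter (\<lambda>v. v < 1/2) xs))"
    if w: "\<And>v. 0 < v \<Longrightarrow> 0 \<le> w v" and q: "0 \<le> q"
      and P: "\<And>A. \<lbrakk>A \<subseteq> {i. i < length xs \<and> xs ! i < 1/2}; 1 \<le> (\<Sum>i\<in>A. xs ! i)\<rbrakk> \<Longrightarrow> p \<le> (\<Sum>i\<in>A. w (xs ! i))"
      and Q: "\<And>A. \<lbrakk>A \<subseteq> {i. i < length xs \<and> xs ! i < 1/2}; 1 - x \<le> (\<Sum>i\<in>A. xs ! i)\<rbrakk> \<Longrightarrow> q \<le> (\<Sum>i\<in>A. w (xs ! i))"
    for w :: "rat \<Rightarrow> rat" and p q x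
  proof -
    \<comment> \<open>The bins of \<open>H\<close> may hold few small items and are dropped. Each
      contains an item above \<open>x\<close>, so \<open>f\<close> maps those items onto a superset
      of \<open>H\<close>.\<close>
    define H where "H = {b \<in> EE. \<exists>i\<in>bg b. x < xs ! i}"
    have H: "H \<subseteq> EE" by (auto simp: H_def)
    have "H \<subseteq> f ` {i. i < ?n \<and> x < xs ! i}" by (auto simp: H_def bg_def)
    then have "card H \<le> card {i. i < ?n \<and> x < xs ! i}"
      by (intro surj_card_le) simp_all
    also have "\<dots> = length (filter (\<lambda>v. x < v) xs)" by (simp add: length_filter_conv_card)
    finally have cH: "card H \<le> length (filter (\<lambda>v. x < v) xs)" .
    have cG: "card (EE - H) = card EE - card H" "card H \<le> card EE"
      using H fin by (auto simp: card_Diff_subset finite_subset card_mono)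
    have "of_nat (card EE) - of_nat (length (filter (\<lambda>v. x < v) xs)) \<le> (of_nat (card (EE - H)) :: rat)"
      using cH cG by (simp add: of_nat_diff)
    then have "p * of_nat (card FF) + q * (of_nat (card EE) - of_nat (length (filter (\<lambda>v. x < v) xs)))
      \<le> p * of_nat (card FF) + q * of_nat (card (EE - H))"
      using q by (intro add_left_mono mult_left_mono)
    also have "\<dots> = (\<Sum>b\<in>FF. p) + (\<Sum>b\<in>EE - H. q)" by (simp add: mult.commute)
    also have "\<dots> \<le> (\<Sum>b\<in>FF. \<Sum>i\<in>sm b. w (xs ! i)) + (\<Sum>b\<in>EE - H. \<Sum>i\<in>sm b. w (xs ! i))"
    proof (intro add_mono sum_mono)
      fix b assume "b \<in> FF"
      then have "bg b = {}" "bin_load xs f b \<ge> 1" using fin by (auto simp: FF_def C_def)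
      then show "p \<le> (\<Sum>i\<in>sm b. w (xs ! i))" using load[of b] by (intro P) (auto simp: sm_def)
    next
      fix b assume b: "b \<in> EE - H"
      then obtain i where i: "bg b = {i}" by (auto simp: EE_def card_1_singleton_iff)
      then have "xs ! i \<le> x" using b by (auto simp: H_def)
      moreover have "bin_load xs f b \<ge> 1" using b by (auto simp: EE_def C_def)
      ultimately show "q \<le> (\<Sum>i\<in>sm b. w (xs ! i))" using load[of b] i by (intro Q) (auto simp: sm_def)
    qed
    also have "\<dots> = (\<Sum>b\<in>FF \<union> (EE - H). \<Sum>i\<in>sm b. w (xs ! i))"
      using fin disj by (subst sum.union_disjoint) auto
    also have "\<dots> \<le> sum_list (map w (filter (\<lambda>v. v < 1/2) xs))"
      using w by (rule tot) (auto simp: Cu)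
    finally show ?thesis .
  qed
  from that[OF 1 2 3] show thesis .
qed

section \<open>Small items in the critical bins\<close>

text \<open>Fullness refers to the virtual load, which equals the actual load only once the bin is
  topped. A bin both full and topped is covered, so the two properties are counted
  separately.\<close>

definition full_bins :: "(rat \<times> rat \<times> bool) list \<Rightarrow> nat" where
  "full_bins crit = length (filter (\<lambda>b. 1 \<le> fst (snd b)) crit)"

definition topped_bins :: "(rat \<times> rat \<times> bool) list \<Rightarrow> nat" where
  "topped_bins crit = length (filter (\<lambda>b. snd (snd b)) crit)"

text \<open>Small items only enter the first critical bin of virtual load below 1, so at most one such
  bin contains small items; \<^term>\<open>e\<close> is the amount in it, \<^term>\<open>K\<close> bounds the amount in every
  other bin, and \<^term>\<open>Z\<close> is the amount outside of the critical bins.\<close>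
definition small_bound :: "rat \<Rightarrow> rat \<Rightarrow> rat \<Rightarrow> rat \<Rightarrow> (rat \<times> rat \<times> bool) list \<Rightarrow> bool" where
  "small_bound x K Z W crit \<longleftrightarrow> (\<exists>e\<ge>0. W \<le> K * of_nat (full_bins crit) + e + Z \<and>
     ((\<forall>j<length crit. 1 \<le> fst (snd (crit ! j))) \<longrightarrow> e = 0) \<and>
     (\<forall>j<length crit. fst (snd (crit ! j)) < 1 \<and> (\<forall>i<j. 1 \<le> fst (snd (crit ! i)))
        \<longrightarrow> e \<le> fst (snd (crit ! j)) - x))"

lemma full_bins_update:
  "j < length crit \<Longrightarrow> full_bins (crit[j := y]) + of_bool (1 \<le> fst (snd (crit ! j)))
    = full_bins crit + of_bool (1 \<le> fst (snd y))"
  unfolding full_bins_def by (rule length_filter_list_update)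

lemma topped_bins_update:
  "j < length crit \<Longrightarrow> topped_bins (crit[j := y]) + of_bool (snd (snd (crit ! j)))
    = topped_bins crit + of_bool (snd (snd y))"
  unfolding topped_bins_def by (rule length_filter_list_update)

lemma length_filter_eq_iff: "length (filter P xs) = length xs \<longleftrightarrow> (\<forall>j<length xs. P (xs ! j))"
  by (metis all_set_conv_all_nth filter_id_conv length_filter_less nat_neq_iff)

text \<open>A large item need not enter the first open bin. If it fills that bin, the amount
  \<open>e\<close> there is below \<open>1 - x\<close>, hence at most \<open>K\<close>: the new full
  bin pays for it and \<open>e\<close> restarts at 0. In all other cases \<open>e\<close> is
  kept.\<close>

lemma small_bound_big:
  assumes I: "small_bound x K Z W crit" and j: "j < length crit"
    and y: "fst (snd (crit ! j)) \<le> fst (snd y)" and K: "1 - x \<le> K"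
    and x: "\<forall>j<length crit. x \<le> fst (snd (crit ! j))"
  shows "small_bound x K Z W (crit[j := y])"
proof -
  let ?v = "\<lambda>c i. fst (snd (c ! i)) :: rat" and ?c = "crit[j := y]"
  from I obtain e where e: "0 \<le> e" "W \<le> K * of_nat (full_bins crit) + e + Z"
    and e0: "(\<forall>j<length crit. 1 \<le> ?v crit j) \<longrightarrow> e = 0"
    and ej: "\<And>j. j<length crit \<Longrightarrow> ?v crit j < 1 \<Longrightarrow> (\<forall>i<j. 1 \<le> ?v crit i) \<Longrightarrow> e \<le> ?v crit j - x"
    unfolding small_bound_def by auto
  have v: "?v ?c i = (if i = j then fst (snd y) else ?v crit i)" if "i < length crit" for i
    using that by auto
  have fb: "full_bins ?c + of_bool (1 \<le> ?v crit j) = full_bins crit + of_bool (1 \<le> fst (snd y))"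
    using j by (rule full_bins_update)
  show ?thesis
  proof (cases "?v crit j < 1 \<and> 1 \<le> fst (snd y)")
    case False
    then have same: "1 \<le> ?v ?c i \<longleftrightarrow> 1 \<le> ?v crit i" "?v crit i \<le> ?v ?c i" if "i < length crit" for i
      using y v[OF that] by auto
    have "full_bins ?c = full_bins crit" using fb False y by (auto split: if_splits)
    moreover have "e \<le> ?v ?c k - x" if "k < length crit" "?v ?c k < 1" "\<forall>i<k. 1 \<le> ?v ?c i" for k
    proof -
      have "e \<le> ?v crit k - x" using that same by (intro ej) (auto simp: not_le[symmetric])
      then show ?thesis using same[OF that(1)] by simp
    qed
    ultimately show ?thesis unfolding small_bound_def using e e0 same by (intro exI[of _ e]) auto
  next
    case True
    then have f: "full_bins ?c = Suc (full_bins crit)" using fb by simp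
    show ?thesis
    proof (cases "\<forall>i<j. 1 \<le> ?v crit i")
      case first: True
      then have "e \<le> K" using ej[of j] j True K by auto
      then have "W \<le> K * of_nat (full_bins ?c) + 0 + Z" using e f by (simp add: algebra_simps)
      moreover have "x \<le> fst (snd y)" using x j y by force
      ultimately show ?thesis unfolding small_bound_def using x v by (intro exI[of _ 0]) auto
    next
      case False
      \<comment> \<open>An earlier bin is open, so the first open bin and its \<open>e\<close> are
        untouched; the extra full bin only raises the bound, as \<open>0 \<le> K\<close>.\<close>
      then obtain i where i: "i < j" "?v crit i < 1" by auto
      have "0 \<le> K" using K True x j by force
      then have "W \<le> K * of_nat (full_bins ?c) + e + Z" using e f by (simp add: algebra_simps)
      moreover have "e \<le> ?v ?c k - x" if k: "k < length crit" "?v ?c k < 1" "\<forall>i<k. 1 \<le> ?v ?c i" for k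
      proof -
        have "k \<le> i" using k i j v[of i] by (metis leI less_trans nat_neq_iff not_le)
        then have "e \<le> ?v crit k - x" using k i j v by (intro ej) auto
        then show ?thesis using v[OF k(1)] \<open>k \<le> i\<close> i by auto
      qed
      moreover have "\<not> (\<forall>j<length crit. 1 \<le> ?v ?c j)" using v[of i] i j
        by (metis less_trans nat_neq_iff not_le)
      ultimately show ?thesis unfolding small_bound_def using e by (intro exI[of _ e]) auto
    qed
  qed
qed

text \<open>If the item fills the bin, the contents before it were below \<open>1 - x\<close>, so
  the total stays within the allowance \<open>K\<close> of a full bin. If not,
  \<open>w \<le> v\<close> lets \<open>e + w\<close> keep up with the virtual load.\<close>

lemma small_bound_small:
  assumes I: "small_bound x K Z W crit" and j: "j < length crit"
    and j1: "fst (snd (crit ! j)) < 1" "\<forall>i<j. 1 \<le> fst (snd (crit ! i))"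
    and y: "fst (snd y) = fst (snd (crit ! j)) + v"
    and w: "0 \<le> w" "w \<le> v" "1 - x + w \<le> K"
    and x: "\<forall>j<length crit. x \<le> fst (snd (crit ! j))"
  shows "small_bound x K Z (W + w) (crit[j := y])"
proof -
  let ?v = "\<lambda>c i. fst (snd (c ! i)) :: rat" and ?c = "crit[j := y]"
  from I obtain e where e: "0 \<le> e" "W \<le> K * of_nat (full_bins crit) + e + Z"
    and "e \<le> ?v crit j - x"
    using j j1 unfolding small_bound_def by auto
  have v: "?v ?c i = (if i = j then fst (snd y) else ?v crit i)" if "i < length crit" for i
    using that by auto
  have fb: "full_bins ?c = full_bins crit + of_bool (1 \<le> fst (snd y))"
    using full_bins_update[OF j, of y] j1 by simp
  show ?thesis
  proof (cases "1 \<le> fst (snd y)")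
    case True
    have "x \<le> fst (snd y)" using x j y w by (simp add: add_increasing2)
    moreover have "W + w \<le> K * of_nat (full_bins ?c) + 0 + Z"
      using e w j1 \<open>e \<le> ?v crit j - x\<close> True fb by (simp add: algebra_simps)
    ultimately show ?thesis unfolding small_bound_def using x v by (intro exI[of _ 0]) auto
  next
    case False
    have "k = j" if "k < length crit" "?v ?c k < 1" "\<forall>i<k. 1 \<le> ?v ?c i" for k
      using that v j1 j False by (metis not_le nat_neq_iff)
    then have "e + w \<le> ?v ?c k - x" if "k < length crit" "?v ?c k < 1" "\<forall>i<k. 1 \<le> ?v ?c i" for k
      using that w \<open>e \<le> ?v crit j - x\<close> y j by fastforce
    moreover have "W + w \<le> K * of_nat (full_bins ?c) + (e + w) + Z" using e fb False by simp
    moreover have "\<not> (\<forall>j<length crit. 1 \<le> ?v ?c j)" using j False by auto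
    ultimately show ?thesis unfolding small_bound_def
      using e w by (intro exI[of _ "e + w"]) auto
  qed
qed

lemma small_bound_outside:
  "small_bound x K Z W crit \<Longrightarrow> Z + w \<le> Z' \<Longrightarrow> small_bound x K Z' (W + w) crit"
  unfolding small_bound_def by (elim exE conjE) (rule exI, auto)

section \<open>An invariant of the run\<close>

text \<open>\<open>r\<close> counts the large items sent to the 2-bin: any two of them cover it, so
  \<open>r div 2\<close> such bins are closed and the parity of \<open>r\<close> tells whether the
  current one is empty. \<open>cs\<close> counts closed small bins, each charged 3/2: load below 1
  before the last item, which is below 1/2. While a critical bin is open, nothing has reached the
  small bin.\<close>

definition dh_inv :: "nat \<Rightarrow> rat \<Rightarrow> (rat \<Rightarrow> rat) \<Rightarrow> rat \<Rightarrow> rat list \<Rightarrow> dh_state \<Rightarrow> bool" where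
  "dh_inv m x w K ys st \<longleftrightarrow> (case st of (crit, l2, ls, c) \<Rightarrow>
     length crit = m \<and>
     topped_bins crit = min m (length (filter (\<lambda>v. x \<le> v) ys)) \<and>
     (\<forall>j<m. x \<le> fst (snd (crit ! j)) \<and>
        fst (snd (crit ! j)) = fst (crit ! j) + (if snd (snd (crit ! j)) then 0 else x)) \<and>
     (\<exists>r cs. r + topped_bins crit = n2 ys \<and> c = r div 2 + cs \<and>
        (if even r then l2 = 0 else 1/2 \<le> l2) \<and> 0 \<le> ls \<and> ls < 1 \<and>
        ((\<exists>j<m. fst (snd (crit ! j)) < 1) \<longrightarrow> cs = 0 \<and> ls = 0) \<and>
        small_bound x K (3/2 * of_nat cs + ls) (sum_list (map w (filter (\<lambda>v. v < 1/2) ys))) crit))"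

lemma dh_invI:
  assumes "length crit = m" "topped_bins crit = min m (length (filter (\<lambda>v. x \<le> v) ys))"
    and "\<And>j. j < m \<Longrightarrow> x \<le> fst (snd (crit ! j)) \<and>
        fst (snd (crit ! j)) = fst (crit ! j) + (if snd (snd (crit ! j)) then 0 else x)"
    and "r + topped_bins crit = n2 ys" "c = r div 2 + cs" "if even r then l2 = 0 else 1/2 \<le> l2"
    and "0 \<le> ls" "ls < 1" "(\<exists>j<m. fst (snd (crit ! j)) < 1) \<longrightarrow> cs = 0 \<and> ls = 0"
    and "small_bound x K (3/2 * of_nat cs + ls) (sum_list (map w (filter (\<lambda>v. v < 1/2) ys))) crit"
  shows "dh_inv m x w K ys (crit, l2, ls, c)"
  unfolding dh_inv_def prod.case using assms by blast

text \<open>For \<open>x < 1\<close> no critical bin starts out full; \<open>m = 0\<close> admits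
  the convention that the threshold is then 1.\<close>

lemma dh_inv_init: "x < 1 \<or> m = 0 \<Longrightarrow> dh_inv m x w K [] (replicate m (0, x, False), 0, 0, 0)"
  by (auto simp: dh_inv_def topped_bins_def full_bins_def n2_def small_bound_def)

text \<open>The four cases follow the branches of \<open>dh_step\<close>. The bound
  \<open>1 - x + w v \<le> K\<close> serves a critical bin filled by a small item, and
  \<open>1 - x \<le> K\<close> one filled by a large item.\<close>

lemma dh_inv_step:
  assumes I: "dh_inv m x w K ys st" and v: "0 < v" "v < 1" and x: "1/2 \<le> x"
    and w: "v < 1/2 \<Longrightarrow> 0 \<le> w v \<and> w v \<le> v \<and> 1 - x + w v \<le> K" and K: "1 - x \<le> K"
  shows "dh_inv m x w K (ys @ [v]) (dh_step x v st)"
proof -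
  obtain crit l2 ls c where st: "st = (crit, l2, ls, c)" by (cases st) auto
  let ?v = "\<lambda>c i. fst (snd (c ! i)) :: rat" and ?h = "\<lambda>c i. snd (snd (c ! i)) :: bool"
  let ?W = "\<lambda>ys. sum_list (map w (filter (\<lambda>v. v < 1/2) ys))"
  from I obtain r cs where len: "length crit = m"
    and top: "topped_bins crit = min m (length (filter (\<lambda>v. x \<le> v) ys))"
    and vl: "\<And>j. j < m \<Longrightarrow> x \<le> ?v crit j"
      "\<And>j. j < m \<Longrightarrow> ?v crit j = fst (crit ! j) + (if ?h crit j then 0 else x)"
    and r: "r + topped_bins crit = n2 ys" "c = r div 2 + cs" "if even r then l2 = 0 else 1/2 \<le> l2"
    and ls: "0 \<le> ls" "ls < 1" and cs: "(\<exists>j<m. ?v crit j < 1) \<longrightarrow> cs = 0 \<and> ls = 0"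
    and sb: "small_bound x K (3/2 * of_nat cs + ls) (?W ys) crit"
    unfolding dh_inv_def st prod.case by blast
  consider (crit) "x \<le> v" "\<exists>j<m. \<not> ?h crit j"
    | (pair) "\<not> (x \<le> v \<and> (\<exists>j<m. \<not> ?h crit j))" "1/2 \<le> v"
    | (fill) "v < 1/2" "\<exists>j<m. ?v crit j < 1"
    | (small) "v < 1/2" "\<not> (\<exists>j<m. ?v crit j < 1)"
    by (meson not_le)
  then show ?thesis
  proof cases
    case crit
    define j where "j = (LEAST j. j < m \<and> \<not> ?h crit j)"
    have j: "j < m" "\<not> ?h crit j" using LeastI_ex[OF crit(2)] by (auto simp: j_def)
    define y where "y = (fst (crit ! j) + v, ?v crit j - x + v, True)"
    have step: "dh_step x v st = (crit[j := y], l2, ls, c)"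
      using crit len by (simp add: st dh_step_def j_def y_def Let_def split: prod.splits)
    have t: "topped_bins (crit[j := y]) = Suc (topped_bins crit)"
      using topped_bins_update[of j crit y] j len by (simp add: y_def)
    \<comment> \<open>An untopped bin keeps the count below \<open>m\<close>, so the minimum grows
      by one.\<close>
    have "topped_bins crit \<noteq> m"
      using length_filter_eq_iff[of "\<lambda>b. snd (snd b)" crit] j len by (auto simp: topped_bins_def)
    then have t2: "Suc (topped_bins crit) = min m (Suc (length (filter (\<lambda>v. x \<le> v) ys)))"
      using top by auto
    have f: "filter (\<lambda>v. v < 1/2) (ys @ [v]) = filter (\<lambda>v. v < 1/2) ys" using crit x by simp
    show ?thesis unfolding step
    proof (rule dh_invI[where r = r and cs = cs])
      show "length (crit[j := y]) = m" using len by simp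
      show "topped_bins (crit[j := y]) = min m (length (filter (\<lambda>v. x \<le> v) (ys @ [v])))"
        using t t2 crit by simp
      show "x \<le> ?v (crit[j := y]) i \<and>
          ?v (crit[j := y]) i = fst (crit[j := y] ! i) + (if ?h (crit[j := y]) i then 0 else x)"
        if "i < m" for i
        using that vl[OF that] j len crit(1) by (cases "i = j") (auto simp: y_def)
      show "r + topped_bins (crit[j := y]) = n2 (ys @ [v])" using crit x r t by (simp add: n2_def)
      show "small_bound x K (3/2 * of_nat cs + ls) (?W (ys @ [v])) (crit[j := y])"
        unfolding f using crit j len vl K by (intro small_bound_big[OF sb]) (auto simp: y_def)
      show "(\<exists>i<m. ?v (crit[j := y]) i < 1) \<longrightarrow> cs = 0 \<and> ls = 0"
      proof
        assume "\<exists>i<m. ?v (crit[j := y]) i < 1"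
        then obtain i where i: "i < m" "?v (crit[j := y]) i < 1" by auto
        then have "?v crit i < 1" using j len crit by (cases "i = j") (auto simp: y_def)
        then show "cs = 0 \<and> ls = 0" using cs i by blast
      qed
    qed (fact r ls)+
  next
    case pair
    \<comment> \<open>A large item reaches the 2-bin if it is below \<open>x\<close> or if all
      critical bins are topped; the minimum is unchanged either way.\<close>
    have "topped_bins crit = m" if "x \<le> v"
      using pair that length_filter_eq_iff[of "\<lambda>b. snd (snd b)" crit] len by (simp add: topped_bins_def)
    then have t: "topped_bins crit = min m (length (filter (\<lambda>v. x \<le> v) (ys @ [v])))"
      using top by auto
    have sb': "small_bound x K (3/2 * of_nat cs + ls) (?W (ys @ [v])) crit"
      using sb pair by simp
    note vl' = conjI[OF vl]
    have n2: "Suc r + topped_bins crit = n2 (ys @ [v])" using r pair by (simp add: n2_def)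
    show ?thesis
    proof (cases "even r")
      case True
      then have step: "dh_step x v st = (crit, v, ls, c)"
        using pair r v len by (auto simp: st dh_step_def dnf_add_def)
      have c: "c = Suc r div 2 + cs" "if even (Suc r) then v = 0 else 1/2 \<le> v"
        using r True pair by simp_all
      show ?thesis unfolding step by (rule dh_invI[OF len t vl' n2 c ls cs sb'])
    next
      case False
      then have "1 \<le> l2 + v" using r pair by auto
      then have step: "dh_step x v st = (crit, 0, ls, Suc c)"
        using pair len by (auto simp: st dh_step_def dnf_add_def)
      have c: "Suc c = Suc r div 2 + cs" "if even (Suc r) then (0 :: rat) = 0 else 1/2 \<le> (0 :: rat)"
        using r False by simp_all
      show ?thesis unfolding step by (rule dh_invI[OF len t vl' n2 c ls cs sb'])
    qed
  next
    case fill
    define j where "j = (LEAST j. j < m \<and> ?v crit j < 1)"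
    have j: "j < m" "?v crit j < 1" using LeastI_ex[OF fill(2)] by (auto simp: j_def)
    have first: "\<forall>i<j. 1 \<le> ?v crit i"
      using not_less_Least[of _ "\<lambda>j. j < m \<and> ?v crit j < 1"] j(1) by (fastforce simp: j_def not_less)
    define y where "y = (fst (crit ! j) + v, ?v crit j + v, ?h crit j)"
    have step: "dh_step x v st = (crit[j := y], l2, ls, c)"
      using fill x len by (simp add: st dh_step_def j_def y_def Let_def split: prod.splits)
    have t: "topped_bins (crit[j := y]) = topped_bins crit"
      using topped_bins_update[of j crit y] j len by (simp add: y_def)
    have f: "filter (\<lambda>v. x \<le> v) (ys @ [v]) = filter (\<lambda>v. x \<le> v) ys"
      "?W (ys @ [v]) = ?W ys + w v"
      using fill x by simp_all
    show ?thesis unfolding step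
    proof (rule dh_invI[where r = r and cs = cs])
      show "length (crit[j := y]) = m" using len by simp
      show "topped_bins (crit[j := y]) = min m (length (filter (\<lambda>v. x \<le> v) (ys @ [v])))"
        unfolding t f by (rule top)
      show "x \<le> ?v (crit[j := y]) i \<and>
          ?v (crit[j := y]) i = fst (crit[j := y] ! i) + (if ?h (crit[j := y]) i then 0 else x)"
        if "i < m" for i
        using that vl[OF that] j len v by (cases "i = j") (auto simp: y_def)
      show "r + topped_bins (crit[j := y]) = n2 (ys @ [v])" using fill r t by (simp add: n2_def)
      show "small_bound x K (3/2 * of_nat cs + ls) (?W (ys @ [v])) (crit[j := y])"
        unfolding f using fill j first len vl w
        by (intro small_bound_small[OF sb]) (auto simp: y_def)
      show "(\<exists>i<m. ?v (crit[j := y]) i < 1) \<longrightarrow> cs = 0 \<and> ls = 0" using fill cs by blast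
    qed (fact r ls)+
  next
    case small
    have t: "topped_bins crit = min m (length (filter (\<lambda>v. x \<le> v) (ys @ [v])))"
      using top small x by simp
    have n2: "r + topped_bins crit = n2 (ys @ [v])" using r small by (simp add: n2_def)
    have W: "?W (ys @ [v]) = ?W ys + w v" using small by simp
    note vl' = conjI[OF vl]
    show ?thesis
    proof (cases "1 \<le> ls + v")
      case True
      then have step: "dh_step x v st = (crit, l2, 0, Suc c)"
        using small len x by (auto simp: st dh_step_def dnf_add_def)
      have c: "Suc c = r div 2 + Suc cs" using r by simp
      have ls': "(0 :: rat) \<le> 0" "(0 :: rat) < 1" by simp_all
      have cs': "(\<exists>j<m. ?v crit j < 1) \<longrightarrow> Suc cs = 0 \<and> (0 :: rat) = 0" using small by blast
      have sb': "small_bound x K (3/2 * of_nat (Suc cs) + 0) (?W (ys @ [v])) crit"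
        unfolding W using small w ls by (intro small_bound_outside[OF sb]) (auto simp: field_simps)
      show ?thesis unfolding step by (rule dh_invI[OF len t vl' n2 c r(3) ls' cs' sb'])
    next
      case False
      then have step: "dh_step x v st = (crit, l2, ls + v, c)"
        using small len x by (auto simp: st dh_step_def dnf_add_def)
      have ls': "0 \<le> ls + v" "ls + v < 1" using ls v False by simp_all
      have cs': "(\<exists>j<m. ?v crit j < 1) \<longrightarrow> cs = 0 \<and> ls + v = 0" using small by blast
      have sb': "small_bound x K (3/2 * of_nat cs + (ls + v)) (?W (ys @ [v])) crit"
        unfolding W using small w by (intro small_bound_outside[OF sb]) auto
      show ?thesis unfolding step by (rule dh_invI[OF len t vl' n2 r(2,3) ls' cs' sb'])
    qed
  qed
qed

lemma dh_inv_fold: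
  assumes "\<forall>v\<in>set xs. 0 < v \<and> v < 1" "1/2 \<le> x" "x < 1 \<or> m = 0"
    and "\<And>v. 0 < v \<Longrightarrow> v < 1/2 \<Longrightarrow> 0 \<le> w v \<and> w v \<le> v \<and> 1 - x + w v \<le> K" "1 - x \<le> K"
  shows "dh_inv m x w K xs (fold (dh_step x) xs (replicate m (0, x, False), 0, 0, 0))"
  using assms(1)
proof (induction xs rule: rev_induct)
  case Nil
  then show ?case using dh_inv_init assms(3) by simp
next
  case (snoc v xs)
  then show ?case using assms by (auto intro!: dh_inv_step)
qed

section \<open>Bins covered for a fixed m\<close>

text \<open>The last hypothesis says that the small items, with sizes truncated at \<^term>\<open>1 - x\<close>, are
  too many to leave a critical bin uncovered.\<close>
lemma dh_run_lower_bound: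
  assumes xs: "\<forall>v\<in>set xs. 0 < v \<and> v < 1" and m: "m \<le> n2 xs" and x: "1/2 \<le> x" "x < 1 \<or> m = 0"
    and top: "m \<le> length (filter (\<lambda>v. x \<le> v) xs)"
    and W: "m = 0 \<or> (1 - x) * (2 * of_nat m - 1) \<le> sum_list (map (\<lambda>v. min v (1 - x)) (filter (\<lambda>v. v < 1/2) xs))"
  obtains cs where "dh_run m x xs = m + (n2 xs - m) div 2 + cs"
    "sum_list (filter (\<lambda>v. v < 1/2) xs) \<le> (3/2 - x) * of_nat m + 3/2 * of_nat cs + 1"
proof -
  define st where "st = fold (dh_step x) xs (replicate m (0, x, False), 0, 0, 0)"
  obtain crit l2 ls c where st': "st = (crit, l2, ls, c)" by (cases st) auto
  let ?v = "\<lambda>c i. fst (snd (c ! i)) :: rat"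
  \<comment> \<open>True sizes: less than \<open>1 - x\<close> before the filling item, which is
    itself below 1/2, gives \<open>K = 3/2 - x\<close>.\<close>
  have "dh_inv m x (\<lambda>v. v) (3/2 - x) xs st"
    unfolding st_def using xs x by (intro dh_inv_fold) auto
  then obtain r cs where len: "length crit = m"
    and top': "topped_bins crit = min m (length (filter (\<lambda>v. x \<le> v) xs))"
    and vl: "\<And>j. j < m \<Longrightarrow> ?v crit j = fst (crit ! j) + (if snd (snd (crit ! j)) then 0 else x)"
    and r: "r + topped_bins crit = n2 xs" "c = r div 2 + cs"
    and ls: "0 \<le> ls" "ls < 1"
    and sb: "small_bound x (3/2 - x) (3/2 * of_nat cs + ls) (sum_list (filter (\<lambda>v. v < 1/2) xs)) crit"
    unfolding dh_inv_def st' by auto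
  have full: "1 \<le> ?v crit j" if "j < m" for j
  proof (rule ccontr)
    assume "\<not> 1 \<le> ?v crit j"
    then have ex: "\<exists>j<m. ?v crit j < 1" using that by auto
    have x: "1/2 \<le> x" "x < 1" using x that by auto
    \<comment> \<open>Truncated sizes: the filling item weighs at most \<open>1 - x\<close>, hence
      \<open>K = 2 * (1 - x)\<close>. Since a critical bin is open, the small bin has received
      nothing and the outside amount is 0.\<close>
    have "dh_inv m x (\<lambda>v. min v (1 - x)) (2 * (1 - x)) xs st"
      unfolding st_def using xs x by (intro dh_inv_fold) (auto simp: min_def)
    then have "small_bound x (2 * (1 - x)) 0 (sum_list (map (\<lambda>v. min v (1 - x)) (filter (\<lambda>v. v < 1/2) xs))) crit"
      using ex unfolding dh_inv_def st' by auto
    then obtain e where e: "sum_list (map (\<lambda>v. min v (1 - x)) (filter (\<lambda>v. v < 1/2) xs))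
        \<le> 2 * (1 - x) * of_nat (full_bins crit) + e"
      and ej: "\<forall>j<m. ?v crit j < 1 \<and> (\<forall>i<j. 1 \<le> ?v crit i) \<longrightarrow> e \<le> ?v crit j - x"
      unfolding small_bound_def len by auto
    define k where "k = (LEAST j. j < m \<and> ?v crit j < 1)"
    have k: "k < m" "?v crit k < 1" using LeastI_ex[OF ex] by (auto simp: k_def)
    have "\<forall>i<k. 1 \<le> ?v crit i"
      using not_less_Least[of _ "\<lambda>j. j < m \<and> ?v crit j < 1"] k(1) by (fastforce simp: k_def not_less)
    then have e1: "e < 1 - x" using ej k by fastforce
    have "full_bins crit \<noteq> m"
      using length_filter_eq_iff[of "\<lambda>b. 1 \<le> fst (snd b)" crit] k len by (fastforce simp: full_bins_def)
    moreover have "full_bins crit \<le> m" unfolding full_bins_def using len by auto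
    \<comment> \<open>At most \<open>m - 1\<close> full bins, plus less than \<open>1 - x\<close> in
      the first open one, total less than \<open>(1 - x) * (2 * of_nat m - 1)\<close>, contradicting
      \<open>W\<close>.\<close>
    ultimately have "of_nat (full_bins crit) \<le> (of_nat m - 1 :: rat)"
      using of_nat_mono[of "Suc (full_bins crit)" m, where 'a = rat] by simp
    then have "2 * (1 - x) * of_nat (full_bins crit) \<le> 2 * (1 - x) * (of_nat m - 1)"
      using x by (intro mult_left_mono) auto
    then have "2 * (1 - x) * of_nat (full_bins crit) + e < (1 - x) * (2 * of_nat m - 1)"
      using e1 by (simp add: algebra_simps)
    then show False using e W k by auto
  qed
  have tm: "topped_bins crit = m" using top top' by simp
  \<comment> \<open>In a topped bin the virtual load is the actual load, so every critical bin is
    really covered.\<close>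
  then have "snd (snd (crit ! j))" if "j < m" for j
    using that length_filter_eq_iff[of "\<lambda>b. snd (snd b)" crit] len by (auto simp: topped_bins_def)
  then have "1 \<le> fst (crit ! j)" if "j < m" for j using vl[OF that] full[OF that] that by auto
  then have "length (filter (\<lambda>b. 1 \<le> fst b) crit) = m"
    using length_filter_eq_iff[of "\<lambda>b. 1 \<le> fst b" crit] len by auto
  moreover have "r = n2 xs - m" using r tm by simp
  ultimately have run: "dh_run m x xs = m + (n2 xs - m) div 2 + cs"
    unfolding dh_run_def st_def[symmetric] st' using r by simp
  have fm: "full_bins crit = m"
    using length_filter_eq_iff[of "\<lambda>b. 1 \<le> fst (snd b)" crit] full len by (auto simp: full_bins_def)
  have "sum_list (filter (\<lambda>v. v < 1/2) xs) \<le> (3/2 - x) * of_nat m + 3/2 * of_nat cs + ls"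
    using sb full len unfolding small_bound_def fm by auto
  then show ?thesis using run ls by (intro that[of cs]) auto
qed

section \<open>Choice of m and the final estimate\<close>

text \<open>Either one summand alone reaches \<open>t\<close>, or truncation at \<open>t\<close>
  changes nothing.\<close>

lemma sum_min_ge:
  fixes g :: "'a \<Rightarrow> rat"
  assumes "finite A" "\<And>i. i \<in> A \<Longrightarrow> 0 \<le> g i" "0 \<le> t" "t \<le> (\<Sum>i\<in>A. g i)"
  shows "t \<le> (\<Sum>i\<in>A. min (g i) t)"
proof (cases "\<exists>i\<in>A. t \<le> g i")
  case True
  then obtain i where i: "i \<in> A" "t \<le> g i" by auto
  then have "min (g i) t \<le> (\<Sum>i\<in>A. min (g i) t)"
    using assms by (intro member_le_sum) auto
  then show ?thesis using i by simp
next
  case False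
  then have "(\<Sum>i\<in>A. min (g i) t) = (\<Sum>i\<in>A. g i)" by (intro sum.cong) auto
  then show ?thesis using assms by simp
qed

theorem theorem1:
  fixes xs :: "rat list"
  assumes "\<forall>v \<in> set xs. 0 < v \<and> v < 1"
  shows "of_nat (DH2 xs) \<ge> (3/5 :: rat) * of_nat (OPT xs) - 19/15"
proof (rule OPT_decomposition[OF assms])
  fix D E F :: nat
  assume opt: "OPT xs = D + E + F" and DE: "2 * D + E \<le> n2 xs"
    and weight: "\<And>(w :: rat \<Rightarrow> rat) p q x. \<lbrakk>\<And>v. 0 < v \<Longrightarrow> 0 \<le> w v; 0 \<le> q;
      \<And>A. \<lbrakk>A \<subseteq> {i. i < length xs \<and> xs ! i < 1/2}; 1 \<le> (\<Sum>i\<in>A. xs ! i)\<rbrakk> \<Longrightarrow> p \<le> (\<Sum>i\<in>A. w (xs ! i));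
      \<And>A. \<lbrakk>A \<subseteq> {i. i < length xs \<and> xs ! i < 1/2}; 1 - x \<le> (\<Sum>i\<in>A. xs ! i)\<rbrakk> \<Longrightarrow> q \<le> (\<Sum>i\<in>A. w (xs ! i))\<rbrakk>
     \<Longrightarrow> p * of_nat F + q * (of_nat E - of_nat (length (filter (\<lambda>v. x < v) xs)))
         \<le> sum_list (map w (filter (\<lambda>v. v < 1/2) xs))"
  \<comment> \<open>The 1 added to \<open>2 * DH2 xs\<close> accounts for a large item left unpaired
    among the \<open>n2 xs - m\<close> outside critical bins; the 1 in the second inequality is the
    load left in the small bin.\<close>
  have lower: "\<exists>cs \<tau>. 0 \<le> \<tau> \<and> 2 * D + E + m + 2 * cs \<le> 2 * DH2 xs + 1 \<and>
      of_nat F + (of_nat E + 1 - of_nat m) * \<tau> \<le> (1/2 + \<tau>) * of_nat m + 3/2 * of_nat cs + (1 :: rat)"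
    if m: "m \<le> E" "3 * m \<le> 2 * F + E + 2" for m
  proof -
    define x where "x = xth xs m"
    define \<tau> where "\<tau> = 1 - x"
    have mn: "m \<le> n2 xs" using m DE by simp
    have ml: "m \<le> length xs" using mn le_trans[OF mn, of "length xs"] by (simp add: n2_def)
    have x: "1/2 \<le> x" "x < 1 \<or> m = 0" "m = 0 \<Longrightarrow> x = 1"
      using xth_ge_half[of m xs] xth_mem[of m xs] mn ml assms
      by (cases "m = 0"; auto simp: x_def xth_def)+
    have \<tau>: "0 \<le> \<tau>" "\<tau> \<le> 1/2" using x by (auto simp: \<tau>_def)
    have top: "m \<le> length (filter (\<lambda>v. x \<le> v) xs)"
      using length_filter_ge_xth[of m xs] ml by (cases "m = 0") (auto simp: x_def)
    \<comment> \<open>For \<open>m \<ge> 1\<close> at most \<open>m - 1\<close> items exceed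
      \<open>x\<close>. For \<open>m = 0\<close> the convention \<open>x = 1\<close> makes
      \<open>\<tau>\<close> zero.\<close>
    have gr: "(of_nat E + 1 - of_nat m) * \<tau> \<le> \<tau> * (of_nat E - of_nat (length (filter (\<lambda>v. x < v) xs)))"
    proof (cases "m = 0")
      case False
      then have "Suc (length (filter (\<lambda>v. x < v) xs)) \<le> m"
        using length_filter_greater_xth[of m xs] ml by (simp add: x_def)
      then have "1 + of_nat (length (filter (\<lambda>v. x < v) xs)) \<le> (of_nat m :: rat)"
        by (metis of_nat_Suc of_nat_le_iff)
      then show ?thesis using \<tau> by (subst mult.commute, intro mult_left_mono) auto
    qed (use x in \<open>simp add: \<tau>_def\<close>)
    have pos: "0 < xs ! i" if "i < length xs" for i using that assms by auto
    have fin: "finite A" if "A \<subseteq> {i. i < length xs \<and> xs ! i < 1/2}" for A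
      using that by (rule finite_subset) simp
    have "1 * of_nat F + \<tau> * (of_nat E - of_nat (length (filter (\<lambda>v. x < v) xs)))
         \<le> sum_list (map (\<lambda>v. v) (filter (\<lambda>v. v < 1/2) xs))"
      using \<tau> by (intro weight) (auto simp: \<tau>_def)
    then have S: "of_nat F + (of_nat E + 1 - of_nat m) * \<tau> \<le> sum_list (filter (\<lambda>v. v < 1/2) xs)"
      using gr by simp
    have "2 * \<tau> * of_nat F + \<tau> * (of_nat E - of_nat (length (filter (\<lambda>v. x < v) xs)))
         \<le> sum_list (map (\<lambda>v. min v \<tau>) (filter (\<lambda>v. v < 1/2) xs))"
    proof (intro weight)
      fix A assume A: "A \<subseteq> {i. i < length xs \<and> xs ! i < 1/2}" "1 \<le> (\<Sum>i\<in>A. xs ! i)"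
      \<comment> \<open>As a small size \<open>v\<close> and \<open>\<tau>\<close> are both at most
        1/2, \<open>2 * \<tau> * v \<le> min v \<tau>\<close>; so small items of total size 1 keep
        weight \<open>2 * \<tau>\<close> after truncation.\<close>
      have "2 * \<tau> \<le> 2 * \<tau> * (\<Sum>i\<in>A. xs ! i)" using A \<tau> by (simp add: mult_le_cancel_left1)
      also have "\<dots> = (\<Sum>i\<in>A. 2 * \<tau> * xs ! i)" by (simp add: sum_distrib_left)
      also have "\<dots> \<le> (\<Sum>i\<in>A. min (xs ! i) \<tau>)"
      proof (rule sum_mono)
        fix i assume "i \<in> A"
        then have i: "0 < xs ! i" "xs ! i < 1/2" using A pos by auto
        have "\<tau> * (2 * xs ! i) \<le> \<tau> * 1" "(2 * \<tau>) * xs ! i \<le> 1 * xs ! i"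
          using i \<tau> by (intro mult_left_mono mult_right_mono; simp)+
        then show "2 * \<tau> * xs ! i \<le> min (xs ! i) \<tau>" by (simp add: mult_ac)
      qed
      finally show "2 * \<tau> \<le> (\<Sum>i\<in>A. min (xs ! i) \<tau>)" .
    next
      fix A assume A: "A \<subseteq> {i. i < length xs \<and> xs ! i < 1/2}" "1 - x \<le> (\<Sum>i\<in>A. xs ! i)"
      show "\<tau> \<le> (\<Sum>i\<in>A. min (xs ! i) \<tau>)"
        using A pos fin[OF A(1)] \<tau> by (intro sum_min_ge) (auto simp: \<tau>_def less_imp_le)
    qed (use \<tau> in auto)
    then have "2 * \<tau> * of_nat F + (of_nat E + 1 - of_nat m) * \<tau>
        \<le> sum_list (map (\<lambda>v. min v \<tau>) (filter (\<lambda>v. v < 1/2) xs))"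
      using gr by simp
    \<comment> \<open>The condition on \<open>m\<close> is exactly 2m - 1 \<le> 2F + (E + 1 - m),
      multiplied here by \<open>\<tau>\<close>.\<close>
    moreover have "of_nat (3 * m) \<le> (of_nat (2 * F + E + 2) :: rat)" using m(2) by (rule of_nat_mono)
    then have "\<tau> * (2 * of_nat m - 1) \<le> \<tau> * (2 * of_nat F + (of_nat E + 1 - of_nat m))"
      using \<tau> by (intro mult_left_mono) auto
    ultimately have "\<tau> * (2 * of_nat m - 1) \<le> sum_list (map (\<lambda>v. min v \<tau>) (filter (\<lambda>v. v < 1/2) xs))"
      by (simp add: algebra_simps)
    then obtain cs where cs: "dh_run m x xs = m + (n2 xs - m) div 2 + cs"
      "sum_list (filter (\<lambda>v. v < 1/2) xs) \<le> (3/2 - x) * of_nat m + 3/2 * of_nat cs + 1"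
      using dh_run_lower_bound[OF assms mn x(1,2) top] unfolding \<tau>_def by auto
    have "dh_run m x xs \<le> DH2 xs"
      unfolding DH2_def x_def using mn by (intro Max_ge) auto
    then have "2 * D + E + m + 2 * cs \<le> 2 * DH2 xs + 1" using cs(1) DE m(1) by linarith
    then show ?thesis using S cs(2) \<tau> by (intro exI[of _ cs] exI[of _ \<tau>]) (auto simp: \<tau>_def)
  qed
  have D: "0 \<le> (of_nat D :: rat)" by simp
  show ?thesis
  proof (cases "4 * F < E")
    case True
    \<comment> \<open>(E + 2F)/3 rounded up, the largest \<open>m\<close> the condition allows. It
      yields at least D + 2E/3 + F/3 - 1/2 bins; beyond 3/5 of each count the surplus E/15 - 4F/15
      is positive as \<open>4 * F < E\<close>.\<close>
    define m where "m = (E + 2 * F + 2) div 3"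
    have m: "m \<le> E" "3 * m \<le> 2 * F + E + 2" "E + 2 * F \<le> 3 * m" using True by (auto simp: m_def)
    obtain cs where "2 * D + E + m + 2 * cs \<le> 2 * DH2 xs + 1" using lower[OF m(1,2)] by blast
    then have "of_nat (2 * D + E + m) \<le> (of_nat (2 * DH2 xs + 1) :: rat)" by (intro of_nat_mono) simp
    moreover have "of_nat (E + 2 * F) \<le> (of_nat (3 * m) :: rat)" using m(3) by (rule of_nat_mono)
    moreover have "of_nat (4 * F) \<le> (of_nat E :: rat)" using True by (intro of_nat_mono) simp
    ultimately show ?thesis
      using D unfolding opt of_nat_add of_nat_mult of_nat_numeral of_nat_1
      by (simp add: field_simps del: of_nat_0_le_iff)
  next
    case False
    \<comment> \<open>E/2 rounded up: \<open>E \<le> 2 * m\<close> secures the gain from critical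
      bins, and \<open>2 * m \<le> E + 1\<close> makes the coefficient of \<open>\<tau>\<close>
      below nonnegative, so that \<open>\<tau>\<close> drops out.\<close>
    define m where "m = (E + 1) div 2"
    have m: "m \<le> E" "3 * m \<le> 2 * F + E + 2" "E \<le> 2 * m" "2 * m \<le> E + 1"
      using False by (auto simp: m_def)
    obtain cs \<tau> where cs: "0 \<le> \<tau>" "2 * D + E + m + 2 * cs \<le> 2 * DH2 xs + 1"
      "of_nat F + (of_nat E + 1 - of_nat m) * \<tau>
         \<le> (1/2 + \<tau>) * of_nat m + 3/2 * of_nat cs + (1 :: rat)"
      using lower[OF m(1,2)] by blast
    have "of_nat (2 * m) \<le> (of_nat (E + 1) :: rat)" using m(4) by (rule of_nat_mono)
    then have "0 \<le> (of_nat E + 1 - 2 * of_nat m) * \<tau>" using cs(1) by simp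
    then have "of_nat F \<le> of_nat m / 2 + 3/2 * of_nat cs + (1 :: rat)"
      using cs(3) by (simp add: algebra_simps)
    moreover have "of_nat (2 * D + E + m + 2 * cs) \<le> (of_nat (2 * DH2 xs + 1) :: rat)"
      using cs(2) by (rule of_nat_mono)
    moreover have "of_nat E \<le> (of_nat (2 * m) :: rat)" using m(3) by (rule of_nat_mono)
    moreover have "of_nat E \<le> (of_nat (4 * F) :: rat)" using False by (intro of_nat_mono) simp
    \<comment> \<open>Eliminating \<open>cs\<close> leaves at least D + 7E/12 + 2F/3 - 7/6 bins;
      against 3/5 of each count, the deficit E/60 is made up by the surplus 4F/60.\<close>
    ultimately show ?thesis
      using D unfolding opt of_nat_add of_nat_mult of_nat_numeral of_nat_1
      by (simp add: field_simps del: of_nat_0_le_iff)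
  qed
qed

end
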